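(* Let $f(r)$ denote the minimum number of edges of an $r$-partite intersecting hypergraph $\mathcal{H}$ with $\tau(\mathcal{H}) \ge r-1$. Then $f(4)=6$, $f(5)=9$, and $12 \le f(6) \le 15$.
   Context: A hypergraph is $r$-partite if its vertex set can be partitioned into $r$ parts such that every edge contains precisely one vertex from each part. A hypergraph is intersecting if every two edges have nonempty intersection. The cover number $\tau(\mathcal{H})$ is the minimum size of a vertex set meeting every edge. *)

theory Defs
  imports Main
begin

text \<open>A (finite) hypergraph is a finite set of edges, each edge a set of vertices.
  Vertices are taken from the countable type nat, which is no restriction for
  finite hypergraphs.\<close>

definition r_partite :: "nat \<Rightarrow> 'a set set \<Rightarrow> bool" where
  "r_partite r H \<longleftrightarrow>
     (\<exists>part :: 'a \<Rightarrow> nat. \<forall>e\<in>H. bij_betw part e {0..<r})"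

definition intersecting :: "'a set set \<Rightarrow> bool" where
  "intersecting H \<longleftrightarrow> (\<forall>e\<in>H. \<forall>e'\<in>H. e \<inter> e' \<noteq> {})"

definition is_cover :: "'a set set \<Rightarrow> 'a set \<Rightarrow> bool" where
  "is_cover H C \<longleftrightarrow> finite C \<and> (\<forall>e\<in>H. C \<inter> e \<noteq> {})"

definition cover_number :: "'a set set \<Rightarrow> nat" where
  "cover_number H = (LEAST k. \<exists>C. is_cover H C \<and> card C = k)"

definition f :: "nat \<Rightarrow> nat" where
  "f r = (LEAST m. \<exists>H :: nat set set. finite H \<and> r_partite r H \<and> intersecting H
            \<and> cover_number H \<ge> r - 1 \<and> card H = m)"

end

theory Submission
  imports Defs
begin

text \<open>
  Lower bounds: a cover of size \<open>k\<close> is built by taking some vertices of a single part, whose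
  edge sets are disjoint, and then covering the remaining edges two at a time, which is possible
  because any two edges meet.  If this fails with \<open>m = 2 k + 1 + s\<close> edges, then in every part the
  degrees satisfy \<open>\<Sum> max (d - 2) 0 \<le> s\<close>, so each part accounts for few pairs of
  intersecting edges, and \<open>r\<close> parts cannot account for all \<open>m (m - 1)\<close> ordered pairs.

  Upper bounds: let \<open>q = r - 1\<close> be a prime power.  The \<open>q\<^sup>2\<close> lines of a projective plane of order
  \<open>q\<close> that miss a fixed point form an intersecting \<open>r\<close>-partite hypergraph, whose parts
  are the lines through that point.  Suitable sets of 6, 9 and 14 of these lines for \<open>q = 3, 4, 5\<close>
  have no cover of size \<open>q - 1\<close>.
\<close>

section \<open>Covers of intersecting hypergraphs\<close>

abbreviation degree :: "'a set set \<Rightarrow> 'a \<Rightarrow> nat" where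
  "degree H v \<equiv> card {e\<in>H. v \<in> e}"

lemma intersecting_mono: "intersecting H \<Longrightarrow> G \<subseteq> H \<Longrightarrow> intersecting G"
  by (auto simp: intersecting_def)

lemma is_cover_Un:
  assumes "is_cover G C" "finite A" "\<And>e. e \<in> H - G \<Longrightarrow> A \<inter> e \<noteq> {}"
  shows "is_cover H (A \<union> C)"
  using assms unfolding is_cover_def by (metis Diff_iff Int_Un_distrib2 Un_empty finite_UnI)

lemma cover_number_le:
  assumes "is_cover H C" "card C \<le> k"
  shows "cover_number H \<le> k"
  unfolding cover_number_def using assms by (metis (mono_tags, lifting) Least_le order_trans)

text \<open>Each chosen vertex lies in two edges at once, since any two edges meet. A last unpaired
  edge is paired with itself.\<close>

lemma pairing_cover:
  assumes "finite H" "intersecting H" "card H \<le> 2 * k"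
  shows "\<exists>C. is_cover H C \<and> card C \<le> k"
  using assms
proof (induction k arbitrary: H)
  case 0
  then show ?case by (auto simp: is_cover_def)
next
  case (Suc k)
  show ?case
  proof (cases "H = {}")
    case True
    then show ?thesis by (auto simp: is_cover_def intro!: exI[of _ "{}"])
  next
    case False
    obtain a b where ab: "a \<in> H" "b \<in> H" "card (H - {a, b}) \<le> 2 * k"
    proof (cases "\<exists>a\<in>H. \<exists>b\<in>H. a \<noteq> b")
      case True
      then obtain a b where "a \<in> H" "b \<in> H" "a \<noteq> b" by blast
      with Suc.prems have "card (H - {a, b}) = card H - 2"
        by (subst card_Diff_subset) auto
      with that[of a b] \<open>a \<in> H\<close> \<open>b \<in> H\<close> Suc.prems show ?thesis by auto
    next
      case unique: False
      from False obtain a where "a \<in> H" by blast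
      with unique have "H - {a, a} = {}" by blast
      then have "card (H - {a, a}) \<le> 2 * k" by (simp only: card.empty)
      with that \<open>a \<in> H\<close> show ?thesis by blast
    qed
    from ab Suc.prems obtain v where v: "v \<in> a" "v \<in> b"
      unfolding intersecting_def by blast
    have "intersecting (H - {a, b})"
      using Suc.prems intersecting_mono by blast
    with Suc.IH[of "H - {a, b}"] Suc.prems ab obtain C
      where C: "is_cover (H - {a, b}) C" "card C \<le> k" by auto
    have "is_cover H ({v} \<union> C)"
      by (rule is_cover_Un[OF C(1)]) (use v in auto)
    moreover have "card ({v} \<union> C) \<le> Suc k"
      using card_Un_le[of "{v}" C] C(2) by simp
    ultimately show ?thesis by blast
  qed
qed

section \<open>Degrees within a part\<close>

definition part_vertices :: "('a \<Rightarrow> nat) \<Rightarrow> 'a set set \<Rightarrow> nat \<Rightarrow> 'a set" where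
  "part_vertices part H i = {v \<in> \<Union>H. part v = i}"

lemma partite_finite_edges:
  fixes part :: "'a \<Rightarrow> nat"
  assumes "\<forall>e\<in>H. bij_betw part e {0..<r}" "e \<in> H"
  shows "finite e"
  using assms bij_betw_finite[of part e "{0..<r}"] by simp

lemma finite_part_vertices:
  assumes "finite H" "\<forall>e\<in>H. bij_betw part e {0..<r}"
  shows "finite (part_vertices part H i)"
proof -
  have "finite (\<Union>H)"
    using assms(1) partite_finite_edges[OF assms(2)] by (rule finite_Union)
  then show ?thesis by (rule rev_finite_subset) (auto simp: part_vertices_def)
qed

text \<open>An edge has at most one vertex in a part, so the edges through different vertices of
  \<open>A\<close> are different and degrees add up without overcount.\<close>

lemma disjoint_part_degrees:
  assumes H: "finite H" "\<forall>e\<in>H. bij_betw part e {0..<r}"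
    and A: "A \<subseteq> part_vertices part H i"
  shows "card {e\<in>H. A \<inter> e \<noteq> {}} = sum (degree H) A"
proof -
  have "finite A" using A finite_part_vertices[OF H] finite_subset by blast
  have "card (\<Union>v\<in>A. {e\<in>H. v \<in> e}) = sum (degree H) A"
  proof (intro card_UN_disjoint ballI impI)
    fix v w assume vw: "v \<in> A" "w \<in> A" "v \<noteq> w"
    with A have "part v = part w" by (auto simp: part_vertices_def)
    moreover have "inj_on part e" if "e \<in> H" for e
      using that H by (auto simp: bij_betw_def)
    ultimately show "{e\<in>H. v \<in> e} \<inter> {e\<in>H. w \<in> e} = {}"
      using vw(3) unfolding inj_on_def by blast
  qed (use \<open>finite A\<close> H in auto)
  moreover have "(\<Union>v\<in>A. {e\<in>H. v \<in> e}) = {e\<in>H. A \<inter> e \<noteq> {}}" by auto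
  ultimately show ?thesis by simp
qed

lemma sum_part_degrees:
  assumes H: "finite H" "\<forall>e\<in>H. bij_betw part e {0..<r}" and "i < r"
  shows "sum (degree H) (part_vertices part H i) = card H"
proof -
  have "part_vertices part H i \<inter> e \<noteq> {}" if "e \<in> H" for e
  proof -
    have "i \<in> part ` e" using that H \<open>i < r\<close> by (auto simp: bij_betw_def)
    then show ?thesis using that by (auto simp: part_vertices_def)
  qed
  then have "{e\<in>H. part_vertices part H i \<inter> e \<noteq> {}} = H" by auto
  with disjoint_part_degrees[OF H order_refl, of i] show ?thesis by simp
qed

text \<open>Take all vertices of degree at least 3 in one part, then pair up the edges left. The
  bound expresses that this strategy needs more than \<open>k\<close> vertices.\<close>

lemma part_excess_bound:
  assumes H: "finite H" "\<forall>e\<in>H. bij_betw part e {0..<r}" "intersecting H"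
    and m: "2 * k < card H" "card H \<le> 3 * k"
    and nocover: "\<And>C. is_cover H C \<Longrightarrow> k < card C"
  shows "(\<Sum>v\<in>part_vertices part H i. degree H v - 2) \<le> card H - 2 * k - 1"
proof -
  define A where "A = {v \<in> part_vertices part H i. 3 \<le> degree H v}"
  have sub: "A \<subseteq> part_vertices part H i" by (auto simp: A_def)
  then have fin: "finite A" using finite_part_vertices[OF H(1,2)] finite_subset by blast
  \<comment> \<open>Otherwise the edges missing \<open>B\<close> could be paired off with the
    remaining budget \<open>k - card B\<close>.\<close>
  have rest: "2 * (k - card B) < card H - sum (degree H) B" if B: "B \<subseteq> A" "card B \<le> k" for B
  proof (rule ccontr)
    assume neg: "\<not> 2 * (k - card B) < card H - sum (degree H) B"
    have "finite B" using B fin finite_subset by blast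
    let ?G = "H - {e\<in>H. B \<inter> e \<noteq> {}}"
    have "card ?G = card H - card {e\<in>H. B \<inter> e \<noteq> {}}"
      using H by (intro card_Diff_subset) auto
    then have "card ?G = card H - sum (degree H) B"
      using disjoint_part_degrees[OF H(1,2), of B i] B sub by auto
    then have "card ?G \<le> 2 * (k - card B)" using neg by linarith
    then obtain C where C: "is_cover ?G C" "card C \<le> k - card B"
      using pairing_cover[of ?G] H intersecting_mono[of H ?G] by auto
    have "is_cover H (B \<union> C)"
      by (rule is_cover_Un[OF C(1) \<open>finite B\<close>]) auto
    moreover have "card (B \<union> C) \<le> k"
      using card_Un_le[of B C] C(2) B by linarith
    ultimately show False using nocover by (meson not_le)
  qed
  have big: "3 * card B \<le> sum (degree H) B" if "B \<subseteq> A" for B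
    using sum_bounded_below[of B 3 "degree H"] subsetD[OF that] by (simp add: A_def mult.commute)
  \<comment> \<open>\<open>k\<close> vertices of degree at least 3 would meet at least
    \<open>3 * k\<close> edges, hence all of \<open>H\<close>.\<close>
  have "card A < k"
  proof (rule ccontr)
    assume "\<not> card A < k"
    then obtain B where "B \<subseteq> A" "card B = k"
      using obtain_subset_with_card_n by (metis not_le_imp_less less_or_eq_imp_le not_less)
    with rest[of B] big[of B] m show False by auto
  qed
  \<comment> \<open>Subtraction truncates, so vertices of degree at most 2 contribute 0.\<close>
  have "(\<Sum>v\<in>part_vertices part H i. degree H v - 2) = (\<Sum>v\<in>A. degree H v - 2)"
    using finite_part_vertices[OF H(1,2)] by (intro sum.mono_neutral_right) (auto simp: A_def)
  also have "\<dots> = sum (degree H) A - 2 * card A"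
    by (subst sum_subtractf_nat) (auto simp: A_def)
  finally show ?thesis
    using rest[OF order_refl] big[OF order_refl] \<open>card A < k\<close> by linarith
qed

section \<open>Counting intersecting pairs\<close>

text \<open>For d = x + 2 one has d (d - 1) = d + x (x + 2), and x \<le> s. Every d (d - 1) is even,
  so the total may be rounded down to an even number; this rounding decides the cases r = 4, m = 5
  and r = 6, m = 11.\<close>

lemma sum_pairs_bound:
  fixes d :: "'a \<Rightarrow> nat"
  assumes "finite V" "(\<Sum>v\<in>V. d v - 2) \<le> s"
  shows "(\<Sum>v\<in>V. d v * (d v - 1)) \<le> 2 * ((sum d V + s * (s + 2)) div 2)"
proof -
  have pt: "d v * (d v - 1) \<le> d v + (d v - 2) * (s + 2)" if "v \<in> V" for v
  proof (cases "2 \<le> d v")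
    case True
    then obtain x where x: "d v = x + 2" by (metis add.commute le_Suc_ex)
    have "d v - 2 \<le> s" using member_le_sum[of v V "\<lambda>v. d v - 2"] that assms by auto
    with x have "x * x \<le> x * s" by simp
    with x show ?thesis by (simp add: algebra_simps)
  next
    case False
    then have "d v = 0 \<or> d v = 1" by linarith
    then show ?thesis by auto
  qed
  have "(\<Sum>v\<in>V. d v * (d v - 1)) \<le> (\<Sum>v\<in>V. d v + (d v - 2) * (s + 2))"
    by (rule sum_mono) (rule pt)
  also have "\<dots> = sum d V + (\<Sum>v\<in>V. d v - 2) * (s + 2)"
    by (simp only: sum.distrib sum_distrib_right)
  also have "\<dots> \<le> sum d V + s * (s + 2)"
    using assms by (intro add_left_mono mult_right_mono) auto
  finally have "(\<Sum>v\<in>V. d v * (d v - 1)) div 2 \<le> (sum d V + s * (s + 2)) div 2"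
    by (rule div_le_mono)
  moreover have "even (\<Sum>v\<in>V. d v * (d v - 1))"
    by (rule dvd_sum) auto
  ultimately show ?thesis by auto
qed

lemma card_ordered_pairs:
  assumes "finite S"
  shows "card {(a, b). a \<in> S \<and> b \<in> S \<and> a \<noteq> b} = card S * (card S - 1)"
proof -
  have "{(a, b). a \<in> S \<and> b \<in> S \<and> a \<noteq> b} = (SIGMA a:S. S - {a})" by auto
  then show ?thesis using assms by simp
qed

text \<open>Each ordered pair of distinct edges is counted at every vertex it shares, so at least
  once.\<close>

lemma intersecting_pairs_le:
  assumes H: "finite H" "\<forall>e\<in>H. bij_betw part e {0..<r}" "intersecting H"
  shows "card H * (card H - 1)
    \<le> (\<Sum>i<r. \<Sum>v\<in>part_vertices part H i. degree H v * (degree H v - 1))"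
proof -
  define P where "P S = {(a, b). a \<in> S \<and> b \<in> S \<and> a \<noteq> b}" for S :: "'a set set"
  have card_P: "card (P S) = card S * (card S - 1)" if "finite S" for S
    unfolding P_def using that by (rule card_ordered_pairs)
  have fin: "finite (\<Union>H)" using H partite_finite_edges[OF H(2)] by auto
  have verts: "\<Union>H = (\<Union>i<r. part_vertices part H i)"
    using H(2) by (force simp: part_vertices_def bij_betw_def)
  have sub: "P H \<subseteq> (\<Union>v\<in>\<Union>H. P {e\<in>H. v \<in> e})"
  proof
    fix p assume "p \<in> P H"
    then obtain a b where p: "p = (a, b)" "a \<in> H" "b \<in> H" "a \<noteq> b" by (auto simp: P_def)
    with H(3) obtain v where "v \<in> a" "v \<in> b" by (auto simp: intersecting_def)
    with p show "p \<in> (\<Union>v\<in>\<Union>H. P {e\<in>H. v \<in> e})" by (auto simp: P_def)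
  qed
  have "finite (P S)" if "finite S" for S
    by (rule finite_subset[of _ "S \<times> S"]) (use that in \<open>auto simp: P_def\<close>)
  then have "finite (\<Union>v\<in>\<Union>H. P {e\<in>H. v \<in> e})"
    by (intro finite_UN_I[OF fin]) (simp add: H(1))
  then have "card (P H) \<le> card (\<Union>v\<in>\<Union>H. P {e\<in>H. v \<in> e})"
    using sub by (rule card_mono)
  also have "\<dots> \<le> (\<Sum>v\<in>\<Union>H. card (P {e\<in>H. v \<in> e}))"
    by (rule card_UN_le[OF fin])
  also have "\<dots> = (\<Sum>v\<in>\<Union>H. degree H v * (degree H v - 1))"
    using H(1) by (simp add: card_P)
  also have "\<dots> = (\<Sum>i<r. \<Sum>v\<in>part_vertices part H i. degree H v * (degree H v - 1))"
    unfolding verts using finite_part_vertices[OF H(1,2)]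
    by (intro sum.UNION_disjoint) (auto simp: part_vertices_def)
  finally show ?thesis using card_P[OF H(1)] by simp
qed

lemma small_cover_exists:
  assumes H: "finite H" "r_partite r H" "intersecting H"
    and m: "card H \<le> 3 * k" "card H = 2 * k + 1 + s"
    and count: "r * (2 * ((card H + s * (s + 2)) div 2)) < card H * (card H - 1)"
  shows "\<exists>C. is_cover H C \<and> card C \<le> k"
proof (rule ccontr)
  assume "\<not> ?thesis"
  then have nocover: "k < card C" if "is_cover H C" for C
    using that by (meson not_le)
  obtain part where part: "\<forall>e\<in>H. bij_betw part e {0..<r}"
    using H(2) by (auto simp: r_partite_def)
  have "(\<Sum>v\<in>part_vertices part H i. degree H v * (degree H v - 1))
      \<le> 2 * ((card H + s * (s + 2)) div 2)" if "i < r" for i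
  proof -
    have "(\<Sum>v\<in>part_vertices part H i. degree H v - 2) \<le> s"
      using part_excess_bound[OF H(1) part H(3) _ m(1) nocover, of i] m(2) by simp
    from sum_pairs_bound[OF finite_part_vertices[OF H(1) part] this]
    show ?thesis using sum_part_degrees[OF H(1) part that] by simp
  qed
  then have "(\<Sum>i<r. \<Sum>v\<in>part_vertices part H i. degree H v * (degree H v - 1))
      \<le> (\<Sum>i<r. 2 * ((card H + s * (s + 2)) div 2))"
    by (intro sum_mono) auto
  with intersecting_pairs_le[OF H(1) part H(3)] count show False by simp
qed

section \<open>Hypergraphs given by lists\<close>

text \<open>The \<open>i\<close>-th entry \<open>x\<close> of a list of length \<open>r\<close> names the vertex \<open>r * x + i\<close>, so that the
  part of a vertex is its residue modulo \<open>r\<close>.\<close>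

definition edge_of :: "nat list \<Rightarrow> nat list" where
  "edge_of xs = map (\<lambda>(i, x). length xs * x + i) (enumerate 0 xs)"

fun coverable :: "nat \<Rightarrow> 'a list list \<Rightarrow> bool" where
  "coverable k [] = True"
| "coverable 0 (e # es) = False"
| "coverable (Suc k) (e # es) =
     list_ex (\<lambda>v. coverable k (filter (\<lambda>e'. \<not> List.member e' v) es)) e"

text \<open>A cover contains some vertex \<open>v\<close> of the first edge, and
  \<open>C - {v}\<close> covers the edges avoiding \<open>v\<close>. Hence a failed search bounds
  every cover from below.\<close>

lemma coverable_if_cover:
  assumes "is_cover (set ` set es) C" "card C \<le> k"
  shows "coverable k es"
  using assms
proof (induction k es arbitrary: C rule: coverable.induct)
  case (2 e es)
  then show ?case by (auto simp: is_cover_def)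
next
  case (3 k e es)
  from 3(2) obtain v where v: "v \<in> C" "v \<in> set e" by (auto simp: is_cover_def)
  let ?es = "filter (\<lambda>e'. \<not> List.member e' v) es"
  have "(C - {v}) \<inter> set e' \<noteq> {}" if "e' \<in> set ?es" for e'
  proof -
    have "C \<inter> set e' \<noteq> {}" "v \<notin> set e'"
      using 3(2) that by (auto simp: is_cover_def)
    then show ?thesis by blast
  qed
  then have "is_cover (set ` set ?es) (C - {v})"
    using 3(2) unfolding is_cover_def by blast
  moreover have "card (C - {v}) \<le> k"
    using 3(2,3) v by (simp add: is_cover_def)
  ultimately have "coverable k ?es" using 3(1)[OF v(2)] by blast
  then show ?case using v(2) by (auto simp: list_ex_iff)
qed simp

definition witness :: "nat \<Rightarrow> nat list list \<Rightarrow> bool" where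
  "witness r es \<longleftrightarrow>
     list_all (\<lambda>e. map (\<lambda>v. v mod r) e = [0..<r]) es \<and>
     list_all (\<lambda>e. list_all (\<lambda>e'. list_ex (List.member e') e) es) es \<and>
     \<not> coverable (r - 2) es"

definition admissible :: "nat \<Rightarrow> nat set set \<Rightarrow> bool" where
  "admissible r H \<longleftrightarrow> finite H \<and> r_partite r H \<and> intersecting H \<and> cover_number H \<ge> r - 1"

lemma f_altdef: "f r = (LEAST m. \<exists>H. admissible r H \<and> card H = m)"
  by (simp add: f_def admissible_def conj_assoc)

lemma witness_admissible:
  assumes "witness r es" "2 \<le> r"
  shows "admissible r (set ` set es)"
proof -
  let ?H = "set ` set es"
  have "bij_betw (\<lambda>v. v mod r) (set e) {0..<r}" if "e \<in> set es" for e
  proof -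
    have eq: "map (\<lambda>v. v mod r) e = [0..<r]"
      using assms that by (auto simp: witness_def list_all_iff)
    then have "inj_on (\<lambda>v. v mod r) (set e)" by (metis distinct_map distinct_upt)
    moreover have "(\<lambda>v. v mod r) ` set e = {0..<r}" by (metis eq set_map set_upt)
    ultimately show ?thesis by (simp add: bij_betw_def)
  qed
  then have partite: "r_partite r ?H" unfolding r_partite_def by blast
  have inter: "intersecting ?H"
    using assms(1) unfolding witness_def intersecting_def
    by (fastforce simp: list_all_iff list_ex_iff)
  \<comment> \<open>Some cover must exist for the \<open>LEAST\<close> in
    \<open>cover_number\<close> to be attained.\<close>
  obtain C where C: "is_cover ?H C"
    using pairing_cover[of ?H "card ?H"] inter by auto
  have "\<exists>C. is_cover ?H C \<and> card C = cover_number ?H"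
    unfolding cover_number_def by (rule LeastI_ex) (use C in blast)
  moreover have "r - 2 < card C" if "is_cover ?H C" for C
    using coverable_if_cover[OF that, of "r - 2"] assms(1) by (fastforce simp: witness_def)
  ultimately have "r - 1 \<le> cover_number ?H" by fastforce
  with partite inter show ?thesis by (simp add: admissible_def)
qed

lemma f_le:
  assumes "witness r es" "2 \<le> r"
  shows "f r \<le> length es"
proof -
  have "f r \<le> card (set ` set es)"
    unfolding f_altdef using witness_admissible[OF assms] by (intro Least_le) blast
  also have "\<dots> \<le> length es"
    by (metis card_length length_map list.set_map)
  finally show ?thesis .
qed

text \<open>Attainment has to be assumed: without it, \<open>LEAST\<close> would be an unspecified number.\<close>

lemma f_ge:
  assumes "admissible r H0" "2 \<le> r"
    and "\<And>H :: nat set set. \<lbrakk>finite H; r_partite r H; intersecting H; card H < m\<rbrakk>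
           \<Longrightarrow> \<exists>C. is_cover H C \<and> card C \<le> r - 2"
  shows "m \<le> f r"
proof -
  have "\<exists>H. admissible r H \<and> card H = f r"
    unfolding f_altdef by (rule LeastI_ex) (use assms(1) in blast)
  then obtain H where H: "admissible r H" "card H = f r" by blast
  show ?thesis
  proof (rule ccontr)
    assume "\<not> m \<le> f r"
    with H assms(3)[of H] obtain C where "is_cover H C" "card C \<le> r - 2"
      by (auto simp: admissible_def)
    then have "cover_number H \<le> r - 2" by (rule cover_number_le)
    with H(1) assms(2) show False by (auto simp: admissible_def)
  qed
qed

text \<open>In all three witnesses an edge is an affine function a + s x over the field with q = r -
  1 elements: entry i < q is its value at i, the last entry its slope s. For q = 4 the field
  elements are coded in binary, with xor as addition. Equal slopes mean meeting at infinity.\<close>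

definition witness4 :: "nat list list" where
  "witness4 = map edge_of
    [[1,1,1,0], [2,2,2,0], [0,1,2,1], [2,0,1,1], [0,2,1,2], [2,1,0,2]]"

definition witness5 :: "nat list list" where
  "witness5 = map edge_of
    [[0,0,0,0,0], [1,1,1,1,0], [2,2,2,2,0], [3,3,3,3,0], [1,0,3,2,1],
     [2,3,0,1,1], [3,1,0,2,2], [2,1,3,0,3], [3,0,2,1,3]]"

definition witness6 :: "nat list list" where
  "witness6 = map edge_of
    [[0,0,0,0,0,0], [1,1,1,1,1,0], [2,2,2,2,2,0], [3,3,3,3,3,0], [4,4,4,4,4,0],
     [4,0,1,2,3,1], [0,2,4,1,3,2], [2,4,1,3,0,2], [3,0,2,4,1,2], [1,4,2,0,3,3],
     [2,0,3,1,4,3], [0,4,3,2,1,4], [3,2,1,0,4,4], [4,3,2,1,0,4]]"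

lemma witness4: "witness 4 witness4" and length_witness4: "length witness4 = 6"
  by code_simp+

lemma witness5: "witness 5 witness5" and length_witness5: "length witness5 = 9"
  by code_simp+

lemma witness6: "witness 6 witness6" and length_witness6: "length witness6 = 14"
  by code_simp+

section \<open>Small covers below the claimed values, for r = 4, 5, 6\<close>

lemma cover4:
  assumes "finite H" "r_partite 4 H" "intersecting H" "card H < 6"
  shows "\<exists>C. is_cover H C \<and> card C \<le> 2"
proof (cases "card H \<le> 4")
  case True
  with assms show ?thesis by (intro pairing_cover) auto
next
  case False
  with assms(4) have "card H = 5" by linarith
  \<comment> \<open>The parts account for at most 4 * 4 = 16 of the 20 ordered pairs.\<close>
  then show ?thesis by (intro small_cover_exists[OF assms(1-3), where s = 0]) simp_all
qed

lemma cover5: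
  assumes "finite H" "r_partite 5 H" "intersecting H" "card H < 9"
  shows "\<exists>C. is_cover H C \<and> card C \<le> 3"
proof (cases "card H \<le> 6")
  case True
  with assms show ?thesis by (intro pairing_cover) auto
next
  case False
  with assms(4) have "card H = 7 \<or> card H = 8" by linarith
  then consider "card H = 7" | "card H = 8" by blast
  then show ?thesis
  proof cases
    case 1
    then show ?thesis by (intro small_cover_exists[OF assms(1-3), where s = 0]) simp_all
  next
    case 2
    then show ?thesis by (intro small_cover_exists[OF assms(1-3), where s = 1]) simp_all
  qed
qed

lemma cover6:
  assumes "finite H" "r_partite 6 H" "intersecting H" "card H < 12"
  shows "\<exists>C. is_cover H C \<and> card C \<le> 4"
proof (cases "card H \<le> 8")
  case True
  with assms show ?thesis by (intro pairing_cover) auto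
next
  case False
  with assms(4) have "card H = 9 \<or> card H = 10 \<or> card H = 11" by linarith
  then consider "card H = 9" | "card H = 10" | "card H = 11" by blast
  then show ?thesis
  proof cases
    case 1
    then show ?thesis by (intro small_cover_exists[OF assms(1-3), where s = 0]) simp_all
  next
    case 2
    then show ?thesis by (intro small_cover_exists[OF assms(1-3), where s = 1]) simp_all
  next
    case 3
    \<comment> \<open>The tightest case: 6 * 18 = 108 against 110 pairs. For 12 edges the count
      would allow 156 against 132, so the method stops here.\<close>
    then show ?thesis by (intro small_cover_exists[OF assms(1-3), where s = 2]) simp_all
  qed
qed

theorem theorem2:
  shows "f 4 = 6 \<and> f 5 = 9 \<and> 12 \<le> f 6 \<and> f 6 \<le> 15"
proof -
  have "6 \<le> f 4"
    by (rule f_ge[OF witness_admissible[OF witness4]]) (simp_all add: cover4)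
  moreover have "9 \<le> f 5"
    by (rule f_ge[OF witness_admissible[OF witness5]]) (simp_all add: cover5)
  moreover have "12 \<le> f 6"
    by (rule f_ge[OF witness_admissible[OF witness6]]) (simp_all add: cover6)
  \<comment> \<open>The witness for r = 6 has 14 edges, one fewer than the bound claimed.\<close>
  moreover have "f 4 \<le> 6" "f 5 \<le> 9" "f 6 \<le> 14"
    using f_le[OF witness4] f_le[OF witness5] f_le[OF witness6]
    by (simp_all add: length_witness4 length_witness5 length_witness6)
  ultimately show ?thesis by simp
qed

end
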